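(* Let $\mathscr{R}$ be the ring of entire functions in one complex variable $z$ of the form $\sum_{j=1}^n p_j\exp(q_j)$ with $n\geq 1$ and $p_j,q_j\in\mathbb{C}[z]$ for each $j$. Let $\mathscr{R}'$ be a subring of $\mathscr{R}$ containing the variable $z$, let $\mathscr{R}'_{\rm cst}=\mathbb{C}\cap\mathscr{R}'$ be its ring of constants, and let $\mathscr{L}_z=\{0,1,z,+,\times,=\}$. If $\mathscr{R}'_{\rm cst}$ is positive existentially definable in $\mathscr{R}'$ over $\mathscr{L}_z$, then $\mathbb{Z}$ is positive existentially definable in $\mathscr{R}'$ over $\mathscr{L}_z$. Furthermore, this is the case if $\mathscr{R}'_{\rm cst}=\mathbb{C}$ (that is, in this case $\mathscr{R}'_{\rm cst}$, and hence $\mathbb{Z}$, is positive existentially definable in $\mathscr{R}'$ over $\mathscr{L}_z$). In particular, $\mathbb{Z}$ is positive existentially definable in $\mathscr{R}$ over $\mathscr{L}_z$.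
   Context: Rings have a unit, and subrings contain it. $\mathscr{R}'$ is viewed as an $\mathscr{L}_z$-structure in the obvious way, the constant symbol $z$ being interpreted as the function $z$. Complex numbers are identified with constant functions. A positive existential formula is one built from atomic formulas using only conjunctions, disjunctions and existential quantifiers. A subset of $\mathscr{R}'$ is positive existentially definable in $\mathscr{R}'$ over $\mathscr{L}_z$ if it is the set of elements of $\mathscr{R}'$ satisfying some positive existential $\mathscr{L}_z$-formula in one free variable, without parameters other than the constant symbols of $\mathscr{L}_z$. *)

theory Defs
  imports Complex_Main "HOL-Computational_Algebra.Polynomial" "HOL-Algebra.Subrings"
begin

section \<open>Positive existential definability over the language of rings with a constant z\<close>

text \<open>A structure for the language with symbols 0, 1, z, +, and multiplication is a ring record
  extended by the interpretation of the constant symbol z; equality is interpreted as equality.\<close>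

record 'a Lz_struct = "'a ring" + zconst :: 'a

datatype Lz_term =
    TVar nat
  | TZero
  | TOne
  | TZ
  | TAdd Lz_term Lz_term
  | TMul Lz_term Lz_term

datatype pe_formula =
    FEq Lz_term Lz_term
  | FAnd pe_formula pe_formula
  | FOr pe_formula pe_formula
  | FEx nat pe_formula

primrec term_vars :: "Lz_term \<Rightarrow> nat set" where
  "term_vars (TVar i) = {i}"
| "term_vars TZero = {}"
| "term_vars TOne = {}"
| "term_vars TZ = {}"
| "term_vars (TAdd s t) = term_vars s \<union> term_vars t"
| "term_vars (TMul s t) = term_vars s \<union> term_vars t"

primrec free_vars :: "pe_formula \<Rightarrow> nat set" where
  "free_vars (FEq s t) = term_vars s \<union> term_vars t"
| "free_vars (FAnd \<phi> \<psi>) = free_vars \<phi> \<union> free_vars \<psi>"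
| "free_vars (FOr \<phi> \<psi>) = free_vars \<phi> \<union> free_vars \<psi>"
| "free_vars (FEx i \<phi>) = free_vars \<phi> - {i}"

primrec term_val :: "'a Lz_struct \<Rightarrow> (nat \<Rightarrow> 'a) \<Rightarrow> Lz_term \<Rightarrow> 'a" where
  "term_val M v (TVar i) = v i"
| "term_val M v TZero = \<zero>\<^bsub>M\<^esub>"
| "term_val M v TOne = \<one>\<^bsub>M\<^esub>"
| "term_val M v TZ = zconst M"
| "term_val M v (TAdd s t) = term_val M v s \<oplus>\<^bsub>M\<^esub> term_val M v t"
| "term_val M v (TMul s t) = term_val M v s \<otimes>\<^bsub>M\<^esub> term_val M v t"

primrec sat :: "'a Lz_struct \<Rightarrow> (nat \<Rightarrow> 'a) \<Rightarrow> pe_formula \<Rightarrow> bool" where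
  "sat M v (FEq s t) \<longleftrightarrow> term_val M v s = term_val M v t"
| "sat M v (FAnd \<phi> \<psi>) \<longleftrightarrow> sat M v \<phi> \<and> sat M v \<psi>"
| "sat M v (FOr \<phi> \<psi>) \<longleftrightarrow> sat M v \<phi> \<or> sat M v \<psi>"
| "sat M v (FEx i \<phi>) \<longleftrightarrow> (\<exists>a\<in>carrier M. sat M (v(i := a)) \<phi>)"

text \<open>The free variable is number 0. The values which the assignment \<open>\<lambda>_. a\<close> gives to the other
  variables are irrelevant, because these do not occur free; so there are no parameters.\<close>

definition pe_definable :: "'a Lz_struct \<Rightarrow> 'a set \<Rightarrow> bool" where
  "pe_definable M S \<longleftrightarrow>
     (\<exists>\<phi>. free_vars \<phi> \<subseteq> {0} \<and> S = {a \<in> carrier M. sat M (\<lambda>_. a) \<phi>})"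


section \<open>The ring of exponential polynomials\<close>

definition exp_polys :: "(complex \<Rightarrow> complex) set" where
  "exp_polys = {f. \<exists>n\<ge>1. \<exists>p q :: nat \<Rightarrow> complex poly.
      f = (\<lambda>z. \<Sum>j=1..n. poly (p j) z * exp (poly (q j) z))}"

definition exp_poly_ring :: "(complex \<Rightarrow> complex) Lz_struct" where
  "exp_poly_ring =
     \<lparr>carrier = exp_polys,
      mult = (\<lambda>f g z. f z * g z), one = (\<lambda>z. 1),
      zero = (\<lambda>z. 0), add = (\<lambda>f g z. f z + g z),
      zconst = (\<lambda>z. z)\<rparr>"

definition const_funs :: "(complex \<Rightarrow> complex) set" where
  "const_funs = range (\<lambda>c z. c)"

definition int_funs :: "(complex \<Rightarrow> complex) set" where
  "int_funs = range (\<lambda>k z. of_int k)"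

definition ring_cst :: "(complex \<Rightarrow> complex) set \<Rightarrow> (complex \<Rightarrow> complex) set" where
  "ring_cst R' = const_funs \<inter> R'"

lemma exp_polysI:
  assumes "finite I" "I \<noteq> {}"
  shows "(\<lambda>z. \<Sum>i\<in>I. poly (p i) z * exp (poly (q i) z)) \<in> exp_polys"
proof -
  obtain h where h: "bij_betw h {1..card I} I"
    using ex_bij_betw_nat_finite_1[OF assms(1)] by blast
  have "card I \<ge> 1" using assms by (simp add: Suc_leI card_gt_0_iff)
  moreover have "(\<lambda>z. \<Sum>i\<in>I. poly (p i) z * exp (poly (q i) z)) =
      (\<lambda>z. \<Sum>j=1..card I. poly ((p \<circ> h) j) z * exp (poly ((q \<circ> h) j) z))"
    by (rule ext) (simp add: sum.reindex_bij_betw[OF h, symmetric])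
  ultimately show ?thesis unfolding exp_polys_def by blast
qed

lemma const_in_exp_polys: "(\<lambda>z. c) \<in> exp_polys"
  using exp_polysI[of "{()}" "\<lambda>_. [:c:]" "\<lambda>_. 0"] by simp

lemma exp_polys_add:
  assumes "f \<in> exp_polys" "g \<in> exp_polys"
  shows "(\<lambda>z. f z + g z) \<in> exp_polys"
proof -
  obtain n :: nat and p q where n: "n \<ge> 1"
    and f: "f = (\<lambda>z. \<Sum>j=1..n. poly (p j) z * exp (poly (q j) z))"
    using assms(1) unfolding exp_polys_def by blast
  obtain m :: nat and r s where g: "g = (\<lambda>z. \<Sum>j=1..m. poly (r j) z * exp (poly (s j) z))"
    using assms(2) unfolding exp_polys_def by blast
  have "{1..n} <+> {1..m} \<noteq> {}" using n by auto
  from exp_polysI[OF _ this, of "case_sum p r" "case_sum q s"]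
  show ?thesis by (simp add: f g sum.Plus)
qed

lemma exp_polys_mult:
  assumes "f \<in> exp_polys" "g \<in> exp_polys"
  shows "(\<lambda>z. f z * g z) \<in> exp_polys"
proof -
  obtain n :: nat and p q where n: "n \<ge> 1"
    and f: "f = (\<lambda>z. \<Sum>j=1..n. poly (p j) z * exp (poly (q j) z))"
    using assms(1) unfolding exp_polys_def by blast
  obtain m :: nat and r s where m: "m \<ge> 1"
    and g: "g = (\<lambda>z. \<Sum>j=1..m. poly (r j) z * exp (poly (s j) z))"
    using assms(2) unfolding exp_polys_def by blast
  have "{1..n} \<times> {1..m} \<noteq> {}" using n m by auto
  from exp_polysI[OF _ this, of "\<lambda>(i, j). p i * r j" "\<lambda>(i, j). q i + s j"]
  have "(\<lambda>z. \<Sum>(i, j)\<in>{1..n} \<times> {1..m}.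
      (poly (p i) z * poly (r j) z) * (exp (poly (q i) z) * exp (poly (s j) z))) \<in> exp_polys"
    by (simp add: case_prod_unfold exp_add)
  moreover have "(\<lambda>z. \<Sum>(i, j)\<in>{1..n} \<times> {1..m}.
      (poly (p i) z * poly (r j) z) * (exp (poly (q i) z) * exp (poly (s j) z))) =
      (\<lambda>z. f z * g z)"
    by (rule ext) (simp add: f g sum_product sum.cartesian_product mult_ac)
  ultimately show ?thesis by simp
qed

lemma cring_exp_poly_ring: "cring exp_poly_ring"
proof (rule cringI)
  show "abelian_group exp_poly_ring"
  proof (rule abelian_groupI)
    fix f assume "f \<in> carrier exp_poly_ring"
    then have "(\<lambda>z. - f z) \<in> exp_polys"
      using exp_polys_mult[OF const_in_exp_polys[of "-1"], of f]
      by (simp add: exp_poly_ring_def)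
    then show "\<exists>g\<in>carrier exp_poly_ring. g \<oplus>\<^bsub>exp_poly_ring\<^esub> f = \<zero>\<^bsub>exp_poly_ring\<^esub>"
      by (intro bexI[of _ "\<lambda>z. - f z"]) (auto simp: exp_poly_ring_def)
  qed (use const_in_exp_polys[of 0] in \<open>auto simp: exp_poly_ring_def exp_polys_add add_ac\<close>)
  show "comm_monoid exp_poly_ring"
    by (rule comm_monoidI)
      (use const_in_exp_polys[of 1] in \<open>auto simp: exp_poly_ring_def exp_polys_mult mult_ac\<close>)
qed (auto simp: exp_poly_ring_def algebra_simps)

end

theory Submission
  imports Defs "HOL-Complex_Analysis.Great_Picard"
begin

text \<open>If \<open>x\<close> and \<open>y\<close> are exponential polynomials with \<open>x\<^sup>2 - (z\<^sup>2 - 1) y\<^sup>2 = 1\<close>, then both are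
  polynomials: the functions \<open>exp q\<close> with \<open>q(0) = 0\<close> are linearly independent over the polynomials,
  and their exponents can be ordered compatibly with addition, so a largest (or smallest) nonzero
  exponent would give \<open>a\<^sup>2 = (z\<^sup>2 - 1) b\<^sup>2\<close> for its two coefficients. For polynomial solutions,
  \<open>y\<close> divides \<open>x'\<close> with constant quotient \<open>\<plusminus>deg x\<close>, and evaluation at 1 gives \<open>y(1) = \<plusminus>deg x\<close>.
  Every integer arises as \<open>y(1)\<close> for a solution in \<open>\<int>[z]\<close>. Hence the integers are the constants \<open>c\<close>
  with \<open>y \<equiv> c\<close> modulo \<open>z - 1\<close> for some solution.\<close>

subsection \<open>Linear independence of exponentials over the polynomials\<close>

text \<open>For nonzero \<open>p\<close>, the product \<open>p * r\<close> has degree at least that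
  of \<open>p\<close>, while differentiation lowers degrees. The left side is the polynomial factor
  in the derivative of \<open>p exp s\<close> when \<open>s' = r\<close>.\<close>

lemma pderiv_plus_mult_eq_0D:
  fixes p r :: "'a :: {idom, semiring_char_0} poly"
  assumes "pderiv p + p * r = 0" "r \<noteq> 0"
  shows "p = 0"
proof (rule ccontr)
  assume p: "p \<noteq> 0"
  have "pderiv p = - (p * r)"
    using assms(1) by (simp add: eq_neg_iff_add_eq_0)
  then have "degree (pderiv p) = degree p + degree r" and "pderiv p \<noteq> 0"
    using p assms(2) by (simp_all add: degree_mult_eq)
  then show False
    by (simp add: degree_pderiv pderiv_eq_0_iff)
qed

text \<open>Divide the relation by one exponential \<open>exp q0\<close>, so that its coefficient
  stands alone, and differentiate until that coefficient is gone. Injectivity of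
  \<open>pderiv\<close> keeps each \<open>q - q0\<close> nonconstant, so differentiation turns
  nonzero coefficients into nonzero ones.\<close>

lemma exp_independent_over_poly:
  fixes S :: "complex poly set"
  assumes "finite S" "inj_on pderiv S"
    and "\<And>z. (\<Sum>q\<in>S. poly (P q) z * exp (poly q z)) = 0"
    and "q \<in> S"
  shows "P q = 0"
  using assms
proof (induction S arbitrary: P q rule: finite_induct)
  case (insert q0 S)
  \<comment> \<open>Inner induction on the number of derivatives that annihilate \<open>c\<close>.
    Once \<open>c = 0\<close>, multiplying back by \<open>exp q0\<close> yields a relation over
    \<open>S\<close> alone.\<close>
  have step: "\<forall>q\<in>S. P q = 0"
    if "(pderiv ^^ n) c = 0"
      and "\<And>z. poly c z + (\<Sum>q\<in>S. poly (P q) z * exp (poly (q - q0) z)) = 0"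
    for n c and P :: "complex poly \<Rightarrow> complex poly"
    using that
  proof (induction n arbitrary: c P)
    case 0
    have "(\<Sum>q\<in>S. poly (P q) z * exp (poly q z)) = 0" for z
    proof -
      have "(\<Sum>q\<in>S. poly (P q) z * exp (poly q z))
          = exp (poly q0 z) * (\<Sum>q\<in>S. poly (P q) z * exp (poly (q - q0) z))"
        by (simp add: sum_distrib_left exp_diff)
      then show ?thesis using 0 by simp
    qed
    then show ?case using insert.IH insert.prems(1) by auto
  next
    case (Suc n)
    let ?Q = "\<lambda>q. pderiv (P q) + P q * pderiv (q - q0)"
    have "poly (pderiv c) z + (\<Sum>q\<in>S. poly (?Q q) z * exp (poly (q - q0) z)) = 0" for z
    proof -
      have "((\<lambda>z. poly c z + (\<Sum>q\<in>S. poly (P q) z * exp (poly (q - q0) z)))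
          has_field_derivative
          poly (pderiv c) z + (\<Sum>q\<in>S. poly (?Q q) z * exp (poly (q - q0) z))) (at z)"
        by (auto intro!: derivative_eq_intros sum.cong simp del: poly_diff simp: algebra_simps)
      then have "((\<lambda>z. 0) has_field_derivative
          poly (pderiv c) z + (\<Sum>q\<in>S. poly (?Q q) z * exp (poly (q - q0) z))) (at z)"
        using Suc.prems(2) by simp
      then show ?thesis
        using DERIV_unique DERIV_const by blast
    qed
    then have Q: "\<forall>q\<in>S. ?Q q = 0"
      using Suc.IH[of "pderiv c" ?Q] Suc.prems(1) by (simp add: funpow_swap1)
    show ?case
    proof
      fix q assume q: "q \<in> S"
      then have "pderiv (q - q0) \<noteq> 0"
        using insert.hyps(2) insert.prems(1) by (auto simp: pderiv_diff inj_on_def)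
      then show "P q = 0"
        using Q q pderiv_plus_mult_eq_0D by blast
    qed
  qed
  have "degree ((pderiv ^^ degree (P q0)) (P q0)) = 0"
    by (simp add: degree_higher_pderiv)
  then have "(pderiv ^^ Suc (degree (P q0))) (P q0) = 0"
    by (simp add: pderiv_eq_0_iff)
  moreover have "poly (P q0) z + (\<Sum>q\<in>S. poly (P q) z * exp (poly (q - q0) z)) = 0" for z
  proof -
    have "exp (poly q0 z) * (poly (P q0) z + (\<Sum>q\<in>S. poly (P q) z * exp (poly (q - q0) z)))
        = (\<Sum>q\<in>insert q0 S. poly (P q) z * exp (poly q z))"
      using insert.hyps by (simp add: sum_distrib_left exp_diff distrib_left)
    then show ?thesis using insert.prems(2) by simp
  qed
  ultimately have S: "\<forall>q\<in>S. P q = 0"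
    by (rule step)
  moreover have "P q0 = 0"
  proof -
    have "poly (P q0) z = 0" for z
      using insert.prems(2)[of z] insert.hyps S by simp
    then show ?thesis using poly_all_0_iff_0 by blast
  qed
  ultimately show ?case using insert.prems(3) by auto
qed simp

text \<open>The constant term of each exponent moves into the coefficient as a factor
  \<open>exp (r(0))\<close>, and then equal exponents are collected. Exponents vanishing at 0 are
  determined by their derivatives, as linear independence requires.\<close>

lemma exp_polys_normal_form:
  assumes "f \<in> exp_polys"
  obtains S a where "finite S" "\<And>q. q \<in> S \<Longrightarrow> poly q 0 = 0"
    "\<And>z. f z = (\<Sum>q\<in>S. poly (a q) z * exp (poly q z))"
proof -
  obtain n :: nat and p r where f: "f = (\<lambda>z. \<Sum>j=1..n. poly (p j) z * exp (poly (r j) z))"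
    using assms unfolding exp_polys_def by blast
  define s where "s = (\<lambda>j. r j - [:poly (r j) 0:])"
  define a where "a = (\<lambda>q. \<Sum>j\<in>{j\<in>{1..n}. s j = q}. [:exp (poly (r j) 0):] * p j)"
  show thesis
  proof (rule that)
    show "finite (s ` {1..n})" by simp
    show "poly q 0 = 0" if "q \<in> s ` {1..n}" for q
      using that by (auto simp: s_def)
    fix z
    have "poly (p j) z * exp (poly (r j) z)
        = poly ([:exp (poly (r j) 0):] * p j) z * exp (poly (s j) z)" for j
      by (simp add: s_def exp_diff)
    then have "f z = (\<Sum>j=1..n. poly ([:exp (poly (r j) 0):] * p j) z * exp (poly (s j) z))"
      unfolding f by (intro sum.cong refl)
    also have "\<dots> = (\<Sum>q\<in>s ` {1..n}. \<Sum>j\<in>{j\<in>{1..n}. s j = q}.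
        poly ([:exp (poly (r j) 0):] * p j) z * exp (poly (s j) z))"
      by (rule sum.image_gen) simp
    also have "\<dots> = (\<Sum>q\<in>s ` {1..n}. poly (a q) z * exp (poly q z))"
      unfolding a_def by (intro sum.cong) (auto simp: poly_sum sum_distrib_right intro!: sum.cong)
    finally show "f z = (\<Sum>q\<in>s ` {1..n}. poly (a q) z * exp (poly q z))" .
  qed
qed

subsection \<open>The Pell equation over the exponential polynomials\<close>

text \<open>The map sends \<open>p\<close> to \<open>(Re p)(t^2) + t (Im p)(t^2)\<close>,
  interleaving real and imaginary parts of the coefficients. The ordered group
  \<open>real poly\<close> thereby induces a translation-invariant total order on exponents.\<close>

lemma exists_additive_embedding_real_poly:
  obtains \<phi> :: "complex poly \<Rightarrow> real poly"
  where "\<And>p q. \<phi> (p + q) = \<phi> p + \<phi> q" "inj \<phi>"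
proof
  let ?e = "\<lambda>h p. pcompose (map_poly h p) [:0, 0, 1:] :: real poly"
  let ?\<phi> = "\<lambda>p. ?e Re p + [:0, 1:] * ?e Im p"
  have add: "map_poly h (p + q) = map_poly h p + map_poly h q"
    if "h 0 = 0" "\<And>x y. h (x + y) = h x + h y" for h :: "complex \<Rightarrow> real" and p q
    by (rule poly_eqI) (simp add: coeff_map_poly that)
  show \<phi>_add: "?\<phi> (p + q) = ?\<phi> p + ?\<phi> q" for p q
    by (simp add: add pcompose_add algebra_simps)
  show "inj ?\<phi>"
  proof (rule injI)
    fix p q assume "?\<phi> p = ?\<phi> q"
    then have *: "poly (?\<phi> p) x = poly (?\<phi> q) x" for x
      by simp
    \<comment> \<open>Evaluation at \<open>x\<close> and \<open>-x\<close> separates the even part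
      from the odd part.\<close>
    have "poly (map_poly Re p) (x * x) = poly (map_poly Re q) (x * x)
        \<and> x * poly (map_poly Im p) (x * x) = x * poly (map_poly Im q) (x * x)" for x
    proof -
      have "poly (map_poly Re p) (x * x) + x * poly (map_poly Im p) (x * x)
          = poly (map_poly Re q) (x * x) + x * poly (map_poly Im q) (x * x)"
        using *[of x] by (simp add: poly_pcompose)
      moreover have "poly (map_poly Re p) (x * x) - x * poly (map_poly Im p) (x * x)
          = poly (map_poly Re q) (x * x) - x * poly (map_poly Im q) (x * x)"
        using *[of "-x"] by (simp add: poly_pcompose)
      ultimately show ?thesis by linarith
    qed
    then have "poly (map_poly Re p) (x * x) = poly (map_poly Re q) (x * x)"
      "poly (map_poly Im p) (x * x) = poly (map_poly Im q) (x * x)" if "x > 0" for x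
      using that by (metis less_irrefl mult_left_cancel)+
    from this[of "sqrt y" for y]
    have ev: "poly (map_poly Re p) y = poly (map_poly Re q) y"
      "poly (map_poly Im p) y = poly (map_poly Im q) y" if "y \<in> {0<..}" for y
      using that by simp_all
    have inf: "infinite {0::real<..}" by (rule infinite_Ioi)
    have eqI: "u = v" if "\<And>y. y \<in> {0<..} \<Longrightarrow> poly u y = poly v y" for u v :: "real poly"
    proof (rule ccontr)
      assume "u \<noteq> v"
      then have "finite {y. poly (u - v) y = 0}"
        by (intro poly_roots_finite) simp
      moreover have "{0<..} \<subseteq> {y. poly (u - v) y = 0}"
        using that by auto
      ultimately show False using inf finite_subset by blast
    qed
    have "map_poly Re p = map_poly Re q" "map_poly Im p = map_poly Im q"
      using ev by (intro eqI; simp)+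
    then show "p = q"
      by (intro poly_eqI complex_eqI) (metis coeff_map_poly zero_complex.sel)+
  qed
qed

text \<open>The order of vanishing at 1 would be even on the left and odd on the right, since
  \<open>z^2 - 1\<close> has a simple zero there.\<close>

lemma square_eq_pell_mult_square_imp_0:
  fixes a b :: "complex poly"
  assumes "a\<^sup>2 = [:-1, 0, 1:] * b\<^sup>2"
  shows "a = 0 \<and> b = 0"
proof -
  have D: "[:-1, 0, 1:] = [:-1, 1:] * [:1, 1 :: complex:]"
    by simp
  have "b = 0"
  proof (rule ccontr)
    assume b: "b \<noteq> 0"
    then have Db: "[:-1, 0, 1:] * b\<^sup>2 \<noteq> 0"
      by (simp only: mult_eq_0_iff power_eq_0_iff pCons_eq_0_iff) simp
    then have a: "a \<noteq> 0"
      using assms by (metis zero_power2)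
    have "Polynomial.order 1 (a\<^sup>2) = 2 * Polynomial.order 1 a"
      using a by (simp add: power2_eq_square order_mult)
    moreover have "Polynomial.order 1 ([:-1, 0, 1:] * b\<^sup>2) = 1 + 2 * Polynomial.order 1 b"
    proof -
      have "Polynomial.order 1 [:-1, 1 :: complex:] = 1"
        using order_power_n_n[of "1 :: complex" 1] by simp
      moreover have "Polynomial.order 1 [:1, 1 :: complex:] = 0"
        by (intro order_0I) simp
      ultimately have "Polynomial.order 1 ([:-1, 1:] * [:1, 1 :: complex:]) = 1"
        by (subst order_mult) simp_all
      then have "Polynomial.order 1 [:-1, 0, 1 :: complex:] = 1"
        by (simp only: D)
      then show ?thesis
        using b unfolding order_mult[OF Db] by (simp add: power2_eq_square order_mult)
    qed
    ultimately have "2 * Polynomial.order 1 a = 1 + 2 * Polynomial.order 1 b"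
      using assms by simp
    then show False by presburger
  qed
  then show ?thesis using assms by simp
qed


lemma inj_on_pderiv: "inj_on pderiv {q :: complex poly. poly q 0 = 0}"
proof (rule inj_onI)
  fix p q :: "complex poly"
  assume "p \<in> {q. poly q 0 = 0}" "q \<in> {q. poly q 0 = 0}" "pderiv p = pderiv q"
  then have "degree (p - q) = 0" and 0: "poly (p - q) 0 = 0"
    by (simp_all add: pderiv_diff flip: pderiv_eq_0_iff)
  then obtain c where "p - q = [:c:]"
    using degree_eq_zeroE by blast
  with 0 show "p = q" by simp
qed

text \<open>If \<open>M\<close> is the largest exponent occurring in \<open>f\<close> or \<open>g\<close>, only the pair \<open>(M, M)\<close>
  contributes to the coefficient of \<open>exp (2 M)\<close> in the Pell equation.\<close>

lemma pell_coeff_eq_0: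
  fixes \<phi> :: "complex poly \<Rightarrow> 'b :: linordered_ab_group_add"
  assumes add: "\<And>p q. \<phi> (p + q) = \<phi> p + \<phi> q" and "inj \<phi>"
    and "finite S" and S0: "\<And>q. q \<in> S \<Longrightarrow> poly q 0 = 0"
    and pell: "\<And>z. (\<Sum>q\<in>S. poly (a q) z * exp (poly q z))\<^sup>2
      - (z\<^sup>2 - 1) * (\<Sum>q\<in>S. poly (b q) z * exp (poly q z))\<^sup>2 = 1"
    and "q \<in> S" "\<phi> q > 0"
  shows "a q = 0 \<and> b q = 0"
proof (rule ccontr)
  assume neg: "\<not> (a q = 0 \<and> b q = 0)"
  define T where "T = {q \<in> S. \<phi> q > 0 \<and> \<not> (a q = 0 \<and> b q = 0)}"
  have "finite (\<phi> ` T)" "\<phi> ` T \<noteq> {}"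
    using assms neg by (auto simp: T_def)
  then have "Max (\<phi> ` T) \<in> \<phi> ` T" by (rule Max_in)
  then obtain M where M: "M \<in> T" "\<phi> M = Max (\<phi> ` T)" by auto
  have M_max: "\<phi> p \<le> \<phi> M" if "p \<in> T" for p
    using that M(2) \<open>finite (\<phi> ` T)\<close> by simp
  define D where "D = [:-1, 0, 1 :: complex:]"
  define t where "t = (\<lambda>(p, r). a p * a r - D * (b p * b r))"
  define s where "s = (\<lambda>(p, r). p + r :: complex poly)"
  \<comment> \<open>\<open>c u\<close> is the total coefficient of \<open>exp u\<close> after the
    right side 1 is moved over; inserting 0 makes room for that 1.\<close>
  define U where "U = insert 0 (s ` (S \<times> S))"
  define c where "c = (\<lambda>u. (\<Sum>x\<in>{x \<in> S \<times> S. s x = u}. t x) - (if u = 0 then 1 else 0))"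
  have fin: "finite (S \<times> S)" "finite U"
    using \<open>finite S\<close> by (simp_all add: U_def)
  have "U \<subseteq> {q. poly q 0 = 0}"
    using S0 by (auto simp: U_def s_def)
  then have inj: "inj_on pderiv U"
    using inj_on_pderiv inj_on_subset by blast
  have "(\<Sum>u\<in>U. poly (c u) z * exp (poly u z)) = 0" for z
  proof -
    have "(\<Sum>x\<in>S \<times> S. poly (t x) z * exp (poly (s x) z))
        = (\<Sum>p\<in>S. poly (a p) z * exp (poly p z))\<^sup>2
          - (z\<^sup>2 - 1) * (\<Sum>p\<in>S. poly (b p) z * exp (poly p z))\<^sup>2"
      by (simp add: power2_eq_square sum_product sum.cartesian_product sum_distrib_left
          t_def s_def D_def exp_add case_prod_unfold algebra_simps flip: sum_subtractf)
    then have "(\<Sum>x\<in>S \<times> S. poly (t x) z * exp (poly (s x) z)) = 1"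
      using pell by simp
    moreover have "(\<Sum>u\<in>U. \<Sum>x\<in>{x \<in> S \<times> S. s x = u}. poly (t x) z * exp (poly (s x) z))
        = (\<Sum>x\<in>S \<times> S. poly (t x) z * exp (poly (s x) z))"
      by (rule sum.group) (use fin in \<open>auto simp: U_def\<close>)
    moreover have "(\<Sum>u\<in>U. poly (c u) z * exp (poly u z))
        = (\<Sum>u\<in>U. (\<Sum>x\<in>{x \<in> S \<times> S. s x = u}. poly (t x) z * exp (poly (s x) z))
            - (if u = 0 then 1 else 0))"
      by (intro sum.cong refl)
        (auto simp: c_def poly_sum left_diff_distrib sum_distrib_right)
    moreover have "(\<Sum>u\<in>U. if u = 0 then 1 else (0 :: complex)) = 1"
      using fin by (simp add: U_def)
    ultimately show ?thesis
      by (simp add: sum_subtractf)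
  qed
  moreover have "M + M \<in> U"
    using M(1) by (force simp: U_def T_def s_def)
  ultimately have "c (M + M) = 0"
    using exp_independent_over_poly[OF fin(2) inj] by blast
  moreover have "\<phi> 0 = 0"
    using add[of 0 0] by simp
  \<comment> \<open>Hence \<open>M + M\<close> is not 0, and the constant 1 does not enter
    \<open>c (M + M)\<close>.\<close>
  moreover have "\<phi> (M + M) > 0"
    unfolding add using M(1) by (intro add_pos_pos) (simp_all add: T_def)
  ultimately have "c (M + M) = 0" "M + M \<noteq> 0" by auto
  moreover have "(\<Sum>x\<in>{x \<in> S \<times> S. s x = M + M}. t x) = (\<Sum>x\<in>{(M, M)}. t x)"
  proof (rule sum.mono_neutral_right)
    show "finite {x \<in> S \<times> S. s x = M + M}" using fin by simp
    show "{(M, M)} \<subseteq> {x \<in> S \<times> S. s x = M + M}"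
      using M(1) by (auto simp: T_def s_def)
    show "\<forall>x\<in>{x \<in> S \<times> S. s x = M + M} - {(M, M)}. t x = 0"
    proof
      fix x assume x: "x \<in> {x \<in> S \<times> S. s x = M + M} - {(M, M)}"
      obtain p r where pr_eq: "x = (p, r)" by fastforce
      with x have pr: "(p, r) \<noteq> (M, M)" "s (p, r) = M + M" "p \<in> S" "r \<in> S"
        by auto
      then have sum: "\<phi> p + \<phi> r = \<phi> M + \<phi> M"
        by (simp add: s_def flip: add)
      have "p \<noteq> M" "r \<noteq> M"
        using pr by (auto simp: s_def)
      then have "\<phi> p \<noteq> \<phi> M" "\<phi> r \<noteq> \<phi> M"
        using \<open>inj \<phi>\<close> by (auto dest: injD)
      \<comment> \<open>The member above \<open>M\<close> is positive and lies outside
        \<open>T\<close>, so both its coefficients vanish and \<open>t x = 0\<close>.\<close>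
      then have "\<phi> p > \<phi> M \<or> \<phi> r > \<phi> M"
        using sum by (metis add_strict_mono less_irrefl linorder_neqE)
      then have "p \<notin> T \<and> \<phi> p > 0 \<or> r \<notin> T \<and> \<phi> r > 0"
        using M_max M(1) by (auto simp: T_def dest: leD less_trans)
      then show "t x = 0"
        using pr by (auto simp: pr_eq T_def t_def)
    qed
  qed
  ultimately have "(a M)\<^sup>2 = [:-1, 0, 1:] * (b M)\<^sup>2"
    by (simp only: c_def t_def D_def) (simp add: power2_eq_square)
  then have "a M = 0 \<and> b M = 0"
    by (rule square_eq_pell_mult_square_imp_0)
  then show False
    using M(1) by (simp add: T_def)
qed

text \<open>Applying the largest-exponent argument to \<open>\<phi>\<close> and to
  \<open>-\<phi>\<close> removes all positive and all negative exponents, leaving only exponent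
  0.\<close>

lemma exp_polys_pell_imp_poly:
  assumes "f \<in> exp_polys" "g \<in> exp_polys"
    and pell: "\<And>z. (f z)\<^sup>2 - (z\<^sup>2 - 1) * (g z)\<^sup>2 = 1"
  obtains p r where "f = poly p" "g = poly r"
proof -
  obtain S1 a1 where 1: "finite S1" "\<And>q. q \<in> S1 \<Longrightarrow> poly q 0 = 0"
    "\<And>z. f z = (\<Sum>q\<in>S1. poly (a1 q) z * exp (poly q z))"
    using exp_polys_normal_form[OF assms(1)] by blast
  obtain S2 b1 where 2: "finite S2" "\<And>q. q \<in> S2 \<Longrightarrow> poly q 0 = 0"
    "\<And>z. g z = (\<Sum>q\<in>S2. poly (b1 q) z * exp (poly q z))"
    using exp_polys_normal_form[OF assms(2)] by blast
  define S where "S = insert 0 (S1 \<union> S2)"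
  define a where "a = (\<lambda>q. if q \<in> S1 then a1 q else 0)"
  define b where "b = (\<lambda>q. if q \<in> S2 then b1 q else 0)"
  have S: "finite S" "\<And>q. q \<in> S \<Longrightarrow> poly q 0 = 0"
    using 1 2 by (auto simp: S_def)
  have f: "f z = (\<Sum>q\<in>S. poly (a q) z * exp (poly q z))" for z
    unfolding 1(3) by (rule sum.mono_neutral_cong_left) (use S in \<open>auto simp: S_def a_def\<close>)
  have g: "g z = (\<Sum>q\<in>S. poly (b q) z * exp (poly q z))" for z
    unfolding 2(3) by (rule sum.mono_neutral_cong_left) (use S in \<open>auto simp: S_def b_def\<close>)
  obtain \<phi> :: "complex poly \<Rightarrow> real poly"
    where \<phi>: "\<And>p q. \<phi> (p + q) = \<phi> p + \<phi> q" "inj \<phi>"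
    using exists_additive_embedding_real_poly by blast
  have \<phi>': "- \<phi> (p + q) = - \<phi> p + - \<phi> q" "inj (\<lambda>p. - \<phi> p)" for p q
    using \<phi> by (auto simp: inj_def)
  have zero: "a q = 0 \<and> b q = 0" if "q \<in> S - {0}" for q
  proof -
    have "\<phi> 0 = 0"
      using \<phi>(1)[of 0 0] by simp
    then have "\<phi> q \<noteq> 0"
      using that \<phi>(2) by (metis DiffD2 injD singletonI)
    then consider "\<phi> q > 0" | "- \<phi> q > 0"
      using neg_0_less_iff_less not_less_iff_gr_or_eq by blast
    then show ?thesis
    proof cases
      case 1
      show ?thesis
        by (rule pell_coeff_eq_0[of \<phi> S]) (use \<phi> S pell f g that 1 in auto)
    next
      case 2
      show ?thesis
        by (rule pell_coeff_eq_0[of "\<lambda>p. - \<phi> p" S]) (use \<phi>' S pell f g that 2 in auto)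
    qed
  qed
  have "0 \<in> S" by (simp add: S_def)
  then have "f z = poly (a 0) z" "g z = poly (b 0) z" for z
    using zero unfolding f g by (simp_all add: sum.remove[OF S(1), of 0])
  then show thesis
    using that by blast
qed

section \<open>Polynomial solutions of the Pell equation and their values at 1\<close>

text \<open>Differentiating the equation shows that \<open>g\<close> divides \<open>f'\<close>. As
  \<open>f'\<close> and \<open>g\<close> have equal degree, the quotient is a constant
  \<open>c\<close>, and leading coefficients give \<open>c = \<plusminus>deg f\<close>. Then
  \<open>f * c = k\<close>, and at 1 this reads \<open>g(1) = f(1) c\<close> with
  \<open>f(1) = \<plusminus>1\<close>.\<close>

lemma poly_pell_at_1_in_Ints:
  fixes f g :: "complex poly"
  assumes pell: "f\<^sup>2 - [:-1, 0, 1:] * g\<^sup>2 = 1"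
  shows "poly g 1 \<in> \<int>"
proof (cases "g = 0")
  case False
  define D where "D = [:-1, 0, 1 :: complex:]"
  define X where "X = [:0, 1 :: complex:]"
  have D': "pderiv D = 2 * X"
    by (simp add: D_def X_def pderiv_pCons numeral_poly)
  have pell: "f\<^sup>2 - D * g\<^sup>2 = 1"
    using pell by (simp only: D_def)
  \<comment> \<open>Chosen so that \<open>(D g^2)' = 2 g k\<close>.\<close>
  define k where "k = X * g + D * pderiv g"
  define h where "h = f * k - D * g * pderiv f"
  have "2 * (f * pderiv f - g * k) = pderiv (f\<^sup>2 - D * g\<^sup>2)"
    by (simp add: power2_eq_square pderiv_mult pderiv_diff D' k_def algebra_simps)
  also have "\<dots> = 0"
    by (simp only: pell pderiv_1)
  finally have ffk: "f * pderiv f = g * k" by simp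
  \<comment> \<open>Multiplying by 1 in its Pell form makes the factor \<open>g\<close> visible once
    \<open>f f'\<close> is replaced by \<open>g k\<close>.\<close>
  have "pderiv f = pderiv f * (f\<^sup>2 - D * g\<^sup>2)"
    by (simp only: pell mult_1_right)
  also have "\<dots> = f * (f * pderiv f) - D * g\<^sup>2 * pderiv f"
    by (simp add: power2_eq_square algebra_simps)
  also have "\<dots> = g * h"
    by (simp only: ffk) (simp add: h_def power2_eq_square algebra_simps)
  finally have f': "pderiv f = g * h" .
  have degD: "degree D = 2" "lead_coeff D = 1" "D \<noteq> 0"
    by (simp_all add: D_def)
  have deg: "degree (D * g\<^sup>2) = 2 + 2 * degree g"
    using False degD by (simp add: degree_mult_eq degree_power_eq)
  have f2: "f\<^sup>2 = 1 + D * g\<^sup>2"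
    using pell by (simp add: algebra_simps)
  have "degree (f\<^sup>2) = 2 + 2 * degree g" "lead_coeff (f\<^sup>2) = lead_coeff (D * g\<^sup>2)"
    unfolding f2 using deg by (simp_all add: degree_add_eq_right lead_coeff_add_le)
  moreover have "f \<noteq> 0"
    using calculation by auto
  ultimately have degf: "degree f = Suc (degree g)"
    and lc: "lead_coeff (f\<^sup>2) = lead_coeff (D * g\<^sup>2)"
    by (simp_all add: degree_power_eq)
  have lc: "(lead_coeff f)\<^sup>2 = (lead_coeff g)\<^sup>2"
    using lc by (simp only: lead_coeff_power lead_coeff_mult degD(2) mult_1_left)
  have degf': "degree (pderiv f) = degree g"
    using degf by (simp add: degree_pderiv)
  have "pderiv f \<noteq> 0"
    using degf by (simp add: pderiv_eq_0_iff)
  then have "degree h = 0"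
    using f' degf' False by (auto simp: degree_mult_eq)
  then obtain c where c: "h = [:c:]"
    using degree_eq_zeroE by blast
  have "Polynomial.coeff (pderiv f) (degree g) = c * lead_coeff g"
    by (simp add: f' c)
  then have "of_nat (degree f) * lead_coeff f = c * lead_coeff g"
    by (simp add: coeff_pderiv degf)
  moreover have "lead_coeff f = lead_coeff g \<or> lead_coeff f = - lead_coeff g"
    using lc power2_eq_iff by blast
  moreover have "lead_coeff g \<noteq> 0" using False by simp
  ultimately have "c = of_nat (degree f) \<or> c = - of_nat (degree f)"
    by (metis minus_mult_commute mult_cancel_right)
  then have "c \<in> \<int>" by auto
  have "g * (f * h) = g * k"
    using ffk f' by (simp add: algebra_simps)
  then have "f * h = k" using False by simp
  then have "poly (f * h) 1 = poly k 1" by simp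
  then have "poly g 1 = poly f 1 * c"
    by (simp add: c k_def X_def D_def mult.commute)
  moreover have "poly (f\<^sup>2) 1 = 1"
    by (simp add: f2 D_def)
  then have "poly f 1 = 1 \<or> poly f 1 = -1"
    by (simp add: power2_eq_1_iff)
  ultimately show ?thesis using \<open>c \<in> \<int>\<close> by auto
qed simp

subsection \<open>Definability in subrings\<close>

lemma subring_exp_polyE:
  assumes "subring R exp_poly_ring"
  shows "R \<subseteq> exp_polys" "(\<lambda>z. 0) \<in> R" "(\<lambda>z. 1) \<in> R"
    "\<And>f g. f \<in> R \<Longrightarrow> g \<in> R \<Longrightarrow> (\<lambda>z. f z + g z) \<in> R"
    "\<And>f g. f \<in> R \<Longrightarrow> g \<in> R \<Longrightarrow> (\<lambda>z. f z * g z) \<in> R"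
    "\<And>f. f \<in> R \<Longrightarrow> (\<lambda>z. - f z) \<in> R"
proof -
  interpret cring exp_poly_ring by (rule cring_exp_poly_ring)
  note R = subringE[OF assms]
  show "R \<subseteq> exp_polys" "(\<lambda>z. 0) \<in> R" "(\<lambda>z. 1) \<in> R"
    using R(1-3) by (simp_all add: exp_poly_ring_def)
  show "\<And>f g. f \<in> R \<Longrightarrow> g \<in> R \<Longrightarrow> (\<lambda>z. f z + g z) \<in> R"
    "\<And>f g. f \<in> R \<Longrightarrow> g \<in> R \<Longrightarrow> (\<lambda>z. f z * g z) \<in> R"
    using R(6,7) by (simp_all add: exp_poly_ring_def)
  fix f assume f: "f \<in> R"
  then have "f \<in> exp_polys"
    using R(1) by (auto simp: exp_poly_ring_def)
  then have "(\<lambda>z. - f z) \<in> exp_polys"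
    using exp_polys_mult[OF const_in_exp_polys[of "-1"], of f] by simp
  then have "\<ominus>\<^bsub>exp_poly_ring\<^esub> f = (\<lambda>z. - f z)"
    using \<open>f \<in> exp_polys\<close> by (intro minus_equality) (auto simp: exp_poly_ring_def)
  then show "(\<lambda>z. - f z) \<in> R"
    using R(5)[OF f] by simp
qed

text \<open>These are the coefficients of \<open>(z + sqrt (z^2 - 1))^n\<close>. The witnesses
  \<open>w\<close> and \<open>v\<close> of the congruences modulo \<open>z - 1\<close> are carried
  through the induction because they must themselves lie in \<open>R\<close>.\<close>

lemma pell_solution_in_subring:
  fixes n :: nat
  assumes R: "subring R exp_poly_ring" and z: "(\<lambda>z. z) \<in> R"
  shows "\<exists>x\<in>R. \<exists>y\<in>R. \<exists>w\<in>R. \<exists>v\<in>R. \<forall>z. (x z)\<^sup>2 - (z\<^sup>2 - 1) * (y z)\<^sup>2 = 1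
    \<and> y z = of_nat n + (z - 1) * w z \<and> x z = 1 + (z - 1) * v z \<and> (\<lambda>z. of_nat n) \<in> R"
proof (induction n)
  case 0
  show ?case
    by (rule bexI[of _ "\<lambda>z. 1"], (rule bexI[of _ "\<lambda>z. 0"])+) (use subring_exp_polyE[OF R] in auto)
next
  case (Suc n)
  note cl = subring_exp_polyE(2-5)[OF R] z
  obtain x y w v where mem: "x \<in> R" "y \<in> R" "w \<in> R" "v \<in> R"
    and n: "(\<lambda>z. of_nat n) \<in> R"
    and pell: "\<And>z. (x z)\<^sup>2 - (z\<^sup>2 - 1) * (y z)\<^sup>2 = 1"
    and y: "\<And>z. y z = of_nat n + (z - 1) * w z" and x: "\<And>z. x z = 1 + (z - 1) * v z"
    using Suc.IH by blast
  have m1: "(\<lambda>z. z + -1) \<in> R"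
    using subring_exp_polyE(4)[OF R z subring_exp_polyE(6)[OF R subring_exp_polyE(3)[OF R]]] by simp
  \<comment> \<open>Multiplication of \<open>x + y sqrt (z^2 - 1)\<close> by
    \<open>z + sqrt (z^2 - 1)\<close>. Differences are written as sums to fit the closure
    rules.\<close>
  define x' where "x' = (\<lambda>z. z * x z + (z + 1) * ((z + -1) * y z))"
  define y' where "y' = (\<lambda>z. x z + z * y z)"
  \<comment> \<open>This is \<open>v + w + y\<close> with \<open>y\<close> expanded:
    \<open>y' - (n + 1) = (x - 1) + (y - n) + (z - 1) y\<close>.\<close>
  define w' where "w' = (\<lambda>z. v z + (w z + (of_nat n + (z + -1) * w z)))"
  define v' where "v' = (\<lambda>z. v z + (x z + (z + 1) * y z))"
  have "x' \<in> R" "y' \<in> R" "w' \<in> R" "v' \<in> R"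
    unfolding x'_def y'_def w'_def v'_def by (intro cl mem n m1)+
  moreover have "(\<lambda>z. of_nat (Suc n)) \<in> R"
    using subring_exp_polyE(4)[OF R n subring_exp_polyE(3)[OF R]] by (simp add: add.commute)
  moreover have "(x' z)\<^sup>2 - (z\<^sup>2 - 1) * (y' z)\<^sup>2 = 1" for z
  proof -
    have "(x' z)\<^sup>2 - (z\<^sup>2 - 1) * (y' z)\<^sup>2 = (x z)\<^sup>2 - (z\<^sup>2 - 1) * (y z)\<^sup>2"
      by (simp add: x'_def y'_def power2_eq_square algebra_simps)
    then show ?thesis using pell by simp
  qed
  moreover have "y' z = of_nat (Suc n) + (z - 1) * w' z" for z
    unfolding y'_def w'_def x y by (simp add: algebra_simps)
  moreover have "x' z = 1 + (z - 1) * v' z" for z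
    unfolding x'_def v'_def by (simp add: x algebra_simps)
  ultimately show ?case by blast
qed

text \<open>Variables 1, 2, 3 stand for \<open>x\<close>, \<open>y\<close>, \<open>w\<close>. The
  language has no subtraction, so negative terms of the Pell equation and of
  \<open>y = c + (z - 1) w\<close> are moved across.\<close>

definition pell_formula :: pe_formula where
  "pell_formula = FEx 1 (FEx 2 (FEx 3 (FAnd
     (FEq (TAdd (TMul (TVar 1) (TVar 1)) (TMul (TVar 2) (TVar 2)))
          (TAdd TOne (TMul (TMul TZ TZ) (TMul (TVar 2) (TVar 2)))))
     (FEq (TAdd (TVar 2) (TVar 3)) (TAdd (TVar 0) (TMul TZ (TVar 3)))))))"

lemma sat_pell_formula:
  "sat (exp_poly_ring\<lparr>carrier := R\<rparr>) (\<lambda>_. c) pell_formula \<longleftrightarrow>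
    (\<exists>x\<in>R. \<exists>y\<in>R. \<exists>w\<in>R. \<forall>z. (x z)\<^sup>2 - (z\<^sup>2 - 1) * (y z)\<^sup>2 = 1 \<and> y z = c z + (z - 1) * w z)"
proof -
  have "X\<^sup>2 - (z\<^sup>2 - 1) * Y\<^sup>2 = 1 \<longleftrightarrow> X * X + Y * Y = 1 + z * z * (Y * Y)"
    "Y = C + (z - 1) * W \<longleftrightarrow> Y + W = C + z * W" for X Y z C W :: complex
  proof -
    have "X\<^sup>2 - (z\<^sup>2 - 1) * Y\<^sup>2 - 1 = X * X + Y * Y - (1 + z * z * (Y * Y))"
      "Y - (C + (z - 1) * W) = Y + W - (C + z * W)"
      by (simp_all add: power2_eq_square algebra_simps)
    then show "X\<^sup>2 - (z\<^sup>2 - 1) * Y\<^sup>2 = 1 \<longleftrightarrow> X * X + Y * Y = 1 + z * z * (Y * Y)"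
      "Y = C + (z - 1) * W \<longleftrightarrow> Y + W = C + z * W"
      by (metis right_minus_eq)+
  qed
  then show ?thesis
    by (simp add: pell_formula_def exp_poly_ring_def fun_eq_iff all_conj_distrib)
qed

lemma int_funs_subset:
  assumes "subring R exp_poly_ring" "(\<lambda>z. z) \<in> R"
  shows "int_funs \<subseteq> R"
proof -
  have n: "(\<lambda>z. of_nat n) \<in> R" for n
    using pell_solution_in_subring[OF assms, of n] by blast
  have "(\<lambda>z. of_int k) \<in> R" for k
  proof (cases k rule: int_cases2)
    case (nonneg n) then show ?thesis using n by simp
  next
    case (nonpos n) then show ?thesis using subring_exp_polyE(6)[OF assms(1) n] by simp
  qed
  then show ?thesis by (auto simp: int_funs_def)
qed

text \<open>The congruence controls only the value at 1, so \<open>pell_formula\<close> is conjoined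
  with a formula defining the constants, which are determined by that value.\<close>

lemma pe_definable_int_funs:
  assumes R: "subring R exp_poly_ring" and z: "(\<lambda>z. z) \<in> R"
    and def: "pe_definable (exp_poly_ring\<lparr>carrier := R\<rparr>) (ring_cst R)"
  shows "pe_definable (exp_poly_ring\<lparr>carrier := R\<rparr>) int_funs"
proof -
  let ?M = "exp_poly_ring\<lparr>carrier := R\<rparr>"
  obtain \<psi> where \<psi>: "free_vars \<psi> \<subseteq> {0}" "ring_cst R = {a \<in> carrier ?M. sat ?M (\<lambda>_. a) \<psi>}"
    using def unfolding pe_definable_def by blast
  have "free_vars (FAnd \<psi> pell_formula) \<subseteq> {0}"
    using \<psi>(1) by (auto simp: pell_formula_def)
  moreover have "int_funs = {a \<in> carrier ?M. sat ?M (\<lambda>_. a) (FAnd \<psi> pell_formula)}"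
  proof (intro equalityI subsetI)
    fix a assume a: "a \<in> int_funs"
    then obtain k where k: "a = (\<lambda>z. of_int k)" by (auto simp: int_funs_def)
    have "a \<in> R" using a int_funs_subset[OF R z] by blast
    then have "a \<in> ring_cst R" using k by (auto simp: ring_cst_def const_funs_def)
    moreover have "sat ?M (\<lambda>_. a) pell_formula"
    proof -
      obtain x y w where mem: "x \<in> R" "y \<in> R" "w \<in> R"
        and pell: "\<And>z. (x z)\<^sup>2 - (z\<^sup>2 - 1) * (y z)\<^sup>2 = 1"
        and y: "\<And>z. y z = of_nat (nat \<bar>k\<bar>) + (z - 1) * w z"
        using pell_solution_in_subring[OF R z, of "nat \<bar>k\<bar>"] by blast
      show ?thesis
      \<comment> \<open>Negative integers come from the symmetry \<open>(y, w)\<close> to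
        \<open>(-y, -w)\<close>.\<close>
      proof (cases "k \<ge> 0")
        case True
        then have "y z = a z + (z - 1) * w z" for z
          by (simp add: y k)
        then show ?thesis
          unfolding sat_pell_formula using mem pell by blast
      next
        case False
        have "(\<lambda>z. - y z) \<in> R" "(\<lambda>z. - w z) \<in> R"
          using mem subring_exp_polyE(6)[OF R] by blast+
        moreover have "- y z = a z + (z - 1) * - w z" for z
          using False by (simp add: y k)
        moreover have "(x z)\<^sup>2 - (z\<^sup>2 - 1) * (- y z)\<^sup>2 = 1" for z
          using pell by simp
        ultimately show ?thesis
          unfolding sat_pell_formula using mem(1)
          by (intro bexI[of _ x] bexI[of _ "\<lambda>z. - y z"] bexI[of _ "\<lambda>z. - w z"]) auto
      qed
    qed
    ultimately show "a \<in> {a \<in> carrier ?M. sat ?M (\<lambda>_. a) (FAnd \<psi> pell_formula)}"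
      using \<psi>(2) by auto
  next
    fix a assume "a \<in> {a \<in> carrier ?M. sat ?M (\<lambda>_. a) (FAnd \<psi> pell_formula)}"
    then have "a \<in> ring_cst R" and sat: "sat ?M (\<lambda>_. a) pell_formula"
      using \<psi>(2) by auto
    then obtain c where c: "a = (\<lambda>z. c)"
      by (auto simp: ring_cst_def const_funs_def)
    from sat obtain x y w where "x \<in> R" "y \<in> R"
      and pell: "\<And>z. (x z)\<^sup>2 - (z\<^sup>2 - 1) * (y z)\<^sup>2 = 1" and y: "\<And>z. y z = a z + (z - 1) * w z"
      unfolding sat_pell_formula by blast
    then have "x \<in> exp_polys" "y \<in> exp_polys"
      using subring_exp_polyE(1)[OF R] by auto
    then obtain p r where xp: "x = poly p" and yr: "y = poly r"
      using exp_polys_pell_imp_poly pell by blast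
    have "poly (p\<^sup>2 - [:-1, 0, 1:] * r\<^sup>2) z = poly 1 z" for z
      using pell[of z] by (simp add: xp yr power2_eq_square algebra_simps)
    then have "p\<^sup>2 - [:-1, 0, 1:] * r\<^sup>2 = 1"
      using poly_eq_poly_eq_iff by blast
    then have "poly r 1 \<in> \<int>"
      by (rule poly_pell_at_1_in_Ints)
    \<comment> \<open>At 1 the term \<open>(z - 1) w\<close> vanishes.\<close>
    moreover have "poly r 1 = c"
      using y[of 1] by (simp add: yr c)
    ultimately show "a \<in> int_funs"
      by (auto simp: int_funs_def c elim!: Ints_cases)
  qed
  ultimately show ?thesis
    unfolding pe_definable_def by blast
qed

section \<open>Definability of the constants by Picard's theorem\<close>

lemma exp_polys_holomorphic:
  assumes "f \<in> exp_polys"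
  shows "f holomorphic_on UNIV"
proof -
  have "(\<lambda>z. poly p z) holomorphic_on UNIV" for p :: "complex poly"
    by (auto simp: holomorphic_on_open intro: poly_DERIV)
  then show ?thesis
    using assms by (auto simp: exp_polys_def intro!: holomorphic_intros)
qed

text \<open>The elements \<open>x\<close> for which \<open>x (x - 1)\<close> is a unit are entire functions omitting the
  values 0 and 1, so they are constant by the little Picard theorem.\<close>

lemma pe_definable_const_funs:
  assumes R: "subring R exp_poly_ring" and "ring_cst R = const_funs"
  shows "pe_definable (exp_poly_ring\<lparr>carrier := R\<rparr>) const_funs"
proof -
  let ?M = "exp_poly_ring\<lparr>carrier := R\<rparr>"
  \<comment> \<open>The constants 0 and 1 are listed separately, since \<open>x (x - 1)\<close> is 0
    there; the last equation is \<open>x (x - 1) b = 1\<close> without subtraction.\<close>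
  define \<psi> where "\<psi> = FOr (FEq (TVar 0) TZero) (FOr (FEq (TVar 0) TOne)
    (FEx 1 (FEq (TMul (TMul (TVar 0) (TVar 0)) (TVar 1)) (TAdd TOne (TMul (TVar 0) (TVar 1))))))"
  have const: "(\<lambda>z. c) \<in> R" for c
    using assms(2) by (auto simp: ring_cst_def const_funs_def)
  have sat: "sat ?M (\<lambda>_. a) \<psi> \<longleftrightarrow>
      a = (\<lambda>z. 0) \<or> a = (\<lambda>z. 1) \<or> (\<exists>b\<in>R. \<forall>z. a z * (a z - 1) * b z = 1)" for a
    by (simp add: \<psi>_def exp_poly_ring_def fun_eq_iff algebra_simps)
  have "free_vars \<psi> \<subseteq> {0}" by (auto simp: \<psi>_def)
  moreover have "const_funs = {a \<in> carrier ?M. sat ?M (\<lambda>_. a) \<psi>}"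
  proof (intro equalityI subsetI)
    fix a assume "a \<in> const_funs"
    then obtain c where c: "a = (\<lambda>z. c)" by (auto simp: const_funs_def)
    have "sat ?M (\<lambda>_. a) \<psi>"
    proof (cases "c = 0 \<or> c = 1")
      case False
      then show ?thesis
        unfolding sat using const
        \<comment> \<open>The inverse lies in \<open>R\<close> because \<open>R\<close> contains
          every complex constant.\<close>
        by (intro disjI2 bexI[of _ "\<lambda>z. 1 / (c * (c - 1))"]) (auto simp: c)
    qed (auto simp: sat c)
    then show "a \<in> {a \<in> carrier ?M. sat ?M (\<lambda>_. a) \<psi>}"
      using const c by simp
  next
    fix a assume "a \<in> {a \<in> carrier ?M. sat ?M (\<lambda>_. a) \<psi>}"
    then have a: "a \<in> R" "sat ?M (\<lambda>_. a) \<psi>" by simp_all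
    from a(2) consider "a = (\<lambda>z. 0)" | "a = (\<lambda>z. 1)"
      | b where "\<And>z. a z * (a z - 1) * b z = 1"
      unfolding sat by blast
    then show "a \<in> const_funs"
    proof cases
      case 3
      then have "a z \<noteq> 0 \<and> a z \<noteq> 1" for z
        by (metis diff_self mult_zero_left mult_zero_right zero_neq_one)
      moreover have "a holomorphic_on UNIV"
        using a(1) subring_exp_polyE(1)[OF R] exp_polys_holomorphic by blast
      ultimately show ?thesis
        using little_Picard_01 by (metis const_funs_def rangeI)
    qed (auto simp: const_funs_def)
  qed
  ultimately show ?thesis
    unfolding pe_definable_def by blast
qed

theorem theorem1p2:
  shows "(\<forall>R'. subring R' exp_poly_ring \<and> (\<lambda>z. z) \<in> R' \<longrightarrow>
            (pe_definable (exp_poly_ring\<lparr>carrier := R'\<rparr>) (ring_cst R') \<longrightarrow>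
               pe_definable (exp_poly_ring\<lparr>carrier := R'\<rparr>) int_funs) \<and>
            (ring_cst R' = const_funs \<longrightarrow>
               pe_definable (exp_poly_ring\<lparr>carrier := R'\<rparr>) (ring_cst R') \<and>
               pe_definable (exp_poly_ring\<lparr>carrier := R'\<rparr>) int_funs)) \<and>
         pe_definable exp_poly_ring int_funs"
proof -
  interpret cring exp_poly_ring by (rule cring_exp_poly_ring)
  have cst: "pe_definable (exp_poly_ring\<lparr>carrier := R\<rparr>) (ring_cst R)"
    if "subring R exp_poly_ring" "ring_cst R = const_funs" for R
    using pe_definable_const_funs[OF that] that(2) by simp
  have "subring exp_polys exp_poly_ring"
    using carrier_is_subring by (simp add: exp_poly_ring_def)
  moreover have "(\<lambda>z. z) \<in> exp_polys"
    using exp_polysI[of "{()}" "\<lambda>_. [:0, 1:]" "\<lambda>_. 0"] by simp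
  moreover have "ring_cst exp_polys = const_funs"
    using const_in_exp_polys by (auto simp: ring_cst_def const_funs_def)
  moreover have "exp_poly_ring\<lparr>carrier := exp_polys\<rparr> = exp_poly_ring"
    by (simp add: exp_poly_ring_def)
  ultimately have "pe_definable exp_poly_ring int_funs"
    using pe_definable_int_funs[of exp_polys] cst[of exp_polys] by simp
  then show ?thesis
    using pe_definable_int_funs cst by blast
qed

end
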